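(* Let $(\mathbb{Z},b,m)$ be a star with two rays which is transient at both $\infty$ and $-\infty$. Then $(\mathbb{Z},b,m)$ does not satisfy the $\ell^2$-Liouville property if and only if at least one of the following conditions holds: (1) $g\in\ell^2(\infty)$ and $m(-\infty)<\infty$. (2) $g\in\ell^2(-\infty)$ and $m(\infty)<\infty$. (3) $m(\mathbb{Z})<\infty$.
   Context: A star with two rays $(\mathbb{Z},b,m)$ consists of the vertex set $\mathbb{Z}$, a symmetric $b\colon\mathbb{Z}\times\mathbb{Z}\to[0,\infty)$ with $b(x,y)>0$ iff $|x-y|=1$, and $m\colon\mathbb{Z}\to(0,\infty)$, extended to subsets by additivity. All functions are real-valued; $\ell^2(\mathbb{Z},m)$ is the space of $f$ with $\sum_x f^2(x)m(x)<\infty$. The formal Laplacian is $\Delta f(x)=\frac1{m(x)}\sum_y b(x,y)(f(x)-f(y))$. A function $f$ is harmonic if $\Delta f=0$. The $\ell^2$-Liouville property holds if every harmonic function in $\ell^2(\mathbb{Z},m)$ is constant. The graph is transient at $\infty$ if $\sum_{k=0}^\infty\frac1{b(k,k+1)}<\infty$ and transient at $-\infty$ if $\sum_{k=0}^\infty\frac1{b(-k,-k-1)}<\infty$. One writes $g\in\ell^2(\infty)$ (the Green's function is in $\ell^2$ at infinity) if $\sum_{r=0}^\infty\left(\sum_{k=r}^\infty\frac1{b(k,k+1)}\right)^2m(r)<\infty$, and $g\in\ell^2(-\infty)$ if $\sum_{r=0}^\infty\left(\sum_{k=r}^\infty\frac1{b(-k,-k-1)}\right)^2m(-r)<\infty$.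 One writes $m(\infty)<\infty$ if $\sum_{r=0}^\infty m(r)<\infty$ and $m(-\infty)<\infty$ if $\sum_{r=0}^\infty m(-r)<\infty$. *)

theory Defs
  imports "HOL-Analysis.Analysis"
begin

definition star_two_rays :: "(int \<Rightarrow> int \<Rightarrow> real) \<Rightarrow> (int \<Rightarrow> real) \<Rightarrow> bool" where
  "star_two_rays b m \<longleftrightarrow>
     (\<forall>x y. b x y \<ge> 0) \<and>
     (\<forall>x y. b x y = b y x) \<and>
     (\<forall>x y. b x y > 0 \<longleftrightarrow> \<bar>x - y\<bar> = 1) \<and>
     (\<forall>x. m x > 0)"

(* On a star with two rays only the terms y = x - 1 and y = x + 1 are nonzero, so the
   infinite sum is finitely supported and defined for every f. *)
definition laplacian ::
  "(int \<Rightarrow> int \<Rightarrow> real) \<Rightarrow> (int \<Rightarrow> real) \<Rightarrow> (int \<Rightarrow> real) \<Rightarrow> int \<Rightarrow> real" where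
  "laplacian b m f x = (1 / m x) * (\<Sum>\<^sub>\<infinity>y\<in>UNIV. b x y * (f x - f y))"

definition harmonic ::
  "(int \<Rightarrow> int \<Rightarrow> real) \<Rightarrow> (int \<Rightarrow> real) \<Rightarrow> (int \<Rightarrow> real) \<Rightarrow> bool" where
  "harmonic b m f \<longleftrightarrow> (\<forall>x. laplacian b m f x = 0)"

definition ell2 :: "(int \<Rightarrow> real) \<Rightarrow> (int \<Rightarrow> real) set" where
  "ell2 m = {f. (\<lambda>x. (f x)\<^sup>2 * m x) summable_on UNIV}"

definition ell2_Liouville :: "(int \<Rightarrow> int \<Rightarrow> real) \<Rightarrow> (int \<Rightarrow> real) \<Rightarrow> bool" where
  "ell2_Liouville b m \<longleftrightarrow>
     (\<forall>f. f \<in> ell2 m \<and> harmonic b m f \<longrightarrow> f constant_on UNIV)"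

(* All series below have nonnegative terms on a star with two rays,
   so finiteness of the sum is expressed as summability. *)

definition transient_at_top :: "(int \<Rightarrow> int \<Rightarrow> real) \<Rightarrow> bool" where
  "transient_at_top b \<longleftrightarrow> summable (\<lambda>k::nat. 1 / b (int k) (int k + 1))"

definition transient_at_bot :: "(int \<Rightarrow> int \<Rightarrow> real) \<Rightarrow> bool" where
  "transient_at_bot b \<longleftrightarrow> summable (\<lambda>k::nat. 1 / b (- int k) (- int k - 1))"

(* The tail series over k \<ge> r has value infinity if the graph is not transient at the
   end in question. As real-valued infsum is 0 in that case, transience has to be
   required explicitly. *)
definition green_ell2_at_top :: "(int \<Rightarrow> int \<Rightarrow> real) \<Rightarrow> (int \<Rightarrow> real) \<Rightarrow> bool" where
  "green_ell2_at_top b m \<longleftrightarrow> transient_at_top b \<and>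
     summable (\<lambda>r::nat. (\<Sum>\<^sub>\<infinity>k\<in>{r..}. 1 / b (int k) (int k + 1))\<^sup>2 * m (int r))"

definition green_ell2_at_bot :: "(int \<Rightarrow> int \<Rightarrow> real) \<Rightarrow> (int \<Rightarrow> real) \<Rightarrow> bool" where
  "green_ell2_at_bot b m \<longleftrightarrow> transient_at_bot b \<and>
     summable (\<lambda>r::nat. (\<Sum>\<^sub>\<infinity>k\<in>{r..}. 1 / b (- int k) (- int k - 1))\<^sup>2 * m (- int r))"

definition finite_mass_at_top :: "(int \<Rightarrow> real) \<Rightarrow> bool" where
  "finite_mass_at_top m \<longleftrightarrow> summable (\<lambda>r::nat. m (int r))"

definition finite_mass_at_bot :: "(int \<Rightarrow> real) \<Rightarrow> bool" where
  "finite_mass_at_bot m \<longleftrightarrow> summable (\<lambda>r::nat. m (- int r))"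

definition finite_total_mass :: "(int \<Rightarrow> real) \<Rightarrow> bool" where
  "finite_total_mass m \<longleftrightarrow> m summable_on UNIV"

end

theory Submission
  imports Defs
begin

text \<open>A function is harmonic iff its flux along the edges is constant, so the harmonic
  functions are \<open>\<beta> h + \<gamma>\<close> for a single strictly increasing function \<open>h\<close>. By transience \<open>h\<close>
  is bounded, and its distance to its limit at an end is the tail series at that end. Hence a
  nonconstant harmonic function that vanishes at an end is square summable there iff
  the Green's function is, and one with nonzero limit is square summable there iff the mass of that
  end is finite. It cannot vanish at both ends, and each other combination is realised by
  a choice of \<open>\<gamma>\<close>.\<close>

text \<open>Rewrites the unordered tail sums in the Green's function conditions as total minus
  partial sum, a form whose consecutive differences are the single terms and whose limit is 0.
  Nonnegativity makes the unordered sum agree with the series.\<close>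

lemma infsum_atLeast_tail:
  fixes a :: "nat \<Rightarrow> real"
  assumes "summable a" "\<And>k. 0 \<le> a k"
  shows "(\<Sum>\<^sub>\<infinity>k\<in>{r..}. a k) = suminf a - sum a {..<r}"
proof -
  have "(a has_sum suminf a) UNIV"
    using assms by (intro norm_summable_imp_has_sum) (auto simp: summable_sums)
  then have "(a has_sum (suminf a - sum a {..<r})) (UNIV - {..<r})"
    by (intro has_sum_Diff has_sum_finite) auto
  moreover have "UNIV - {..<r} = {r..}" by auto
  ultimately show ?thesis by (metis infsumI)
qed

lemma tail_tendsto_0:
  fixes a :: "nat \<Rightarrow> real"
  assumes "summable a"
  shows "(\<lambda>r. suminf a - sum a {..<r}) \<longlonglongrightarrow> 0"
  using tendsto_diff[OF tendsto_const[of "suminf a"] summable_LIMSEQ[OF assms]] by simp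

text \<open>Applied to each end separately: \<open>w\<close> is the mass along the ray,
  \<open>u\<close> the tail series, and \<alpha> the limit of the harmonic function there. If
  \<alpha> is nonzero, the squared factor eventually lies between half and twice its positive limit,
  so comparison in both directions removes it; otherwise only the constant \<beta> squared has to be
  pulled out.\<close>

lemma summable_square_weighted_iff:
  fixes u w :: "nat \<Rightarrow> real"
  assumes w: "\<And>r. 0 \<le> w r" and u: "u \<longlonglongrightarrow> 0" and "\<beta> \<noteq> 0"
  shows "summable (\<lambda>r. (\<alpha> + \<beta> * u r)\<^sup>2 * w r) \<longleftrightarrow>
    (if \<alpha> = 0 then summable (\<lambda>r. (u r)\<^sup>2 * w r) else summable w)"
proof (cases "\<alpha> = 0")
  case True
  have "(\<lambda>r. (\<alpha> + \<beta> * u r)\<^sup>2 * w r) = (\<lambda>r. \<beta>\<^sup>2 * ((u r)\<^sup>2 * w r))"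
    using True by (auto simp: power_mult_distrib)
  then show ?thesis
    using True \<open>\<beta> \<noteq> 0\<close> by (simp add: summable_cmult_iff)
next
  case False
  have "(\<lambda>r. (\<alpha> + \<beta> * u r)\<^sup>2) \<longlonglongrightarrow> (\<alpha> + \<beta> * 0)\<^sup>2"
    by (intro tendsto_intros u)
  then have lim: "(\<lambda>r. (\<alpha> + \<beta> * u r)\<^sup>2) \<longlonglongrightarrow> \<alpha>\<^sup>2" by simp
  have "\<alpha>\<^sup>2 > 0" using False by simp
  then have lo: "\<forall>\<^sub>F r in sequentially. \<alpha>\<^sup>2 / 2 < (\<alpha> + \<beta> * u r)\<^sup>2"
    and hi: "\<forall>\<^sub>F r in sequentially. (\<alpha> + \<beta> * u r)\<^sup>2 < 2 * \<alpha>\<^sup>2"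
    by (intro order_tendstoD[OF lim]; simp)+
  have "summable w" if s: "summable (\<lambda>r. (\<alpha> + \<beta> * u r)\<^sup>2 * w r)"
  proof (rule summable_comparison_test_ev)
    show "summable (\<lambda>r. 2 / \<alpha>\<^sup>2 * ((\<alpha> + \<beta> * u r)\<^sup>2 * w r))"
      using s by (rule summable_mult)
    show "\<forall>\<^sub>F r in sequentially. norm (w r) \<le> 2 / \<alpha>\<^sup>2 * ((\<alpha> + \<beta> * u r)\<^sup>2 * w r)"
      using lo
    proof eventually_elim
      case (elim r)
      have "1 * w r \<le> (2 / \<alpha>\<^sup>2 * (\<alpha> + \<beta> * u r)\<^sup>2) * w r"
        using elim w[of r] False by (intro mult_right_mono) (auto simp: field_simps)
      then show ?case using w[of r] by (simp add: mult.assoc)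
    qed
  qed
  moreover have "summable (\<lambda>r. (\<alpha> + \<beta> * u r)\<^sup>2 * w r)" if s: "summable w"
  proof (rule summable_comparison_test_ev)
    show "summable (\<lambda>r. 2 * \<alpha>\<^sup>2 * w r)"
      using s by (rule summable_mult)
    show "\<forall>\<^sub>F r in sequentially. norm ((\<alpha> + \<beta> * u r)\<^sup>2 * w r) \<le> 2 * \<alpha>\<^sup>2 * w r"
      using hi
    proof eventually_elim
      case (elim r)
      then have "(\<alpha> + \<beta> * u r)\<^sup>2 * w r \<le> 2 * \<alpha>\<^sup>2 * w r"
        using w[of r] by (intro mult_right_mono) auto
      then show ?case using w[of r] by simp
    qed
  qed
  ultimately show ?thesis using False by auto
qed

text \<open>Both half-lines contain 0; the overlap is harmless because only summability is claimed,
  not the value of the sum.\<close>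

lemma summable_on_int_iff:
  fixes F :: "int \<Rightarrow> real"
  assumes "\<And>x. 0 \<le> F x"
  shows "F summable_on UNIV \<longleftrightarrow>
    summable (\<lambda>r. F (int r)) \<and> summable (\<lambda>r. F (- int r))"
proof -
  have "range int = {0..}"
    by (auto simp: image_iff) (metis nonneg_int_cases)
  then have pos: "F summable_on {0..} \<longleftrightarrow> summable (\<lambda>r. F (int r))"
    using summable_on_reindex[of int UNIV F] assms
    by (simp add: o_def summable_on_UNIV_nonneg_real_iff)
  have "range (\<lambda>r. - int r) = {..0}"
    by (auto simp: image_iff) (metis add.inverse_inverse neg_0_le_iff_le nonneg_int_cases)
  then have neg: "F summable_on {..0} \<longleftrightarrow> summable (\<lambda>r. F (- int r))"
    using summable_on_reindex[of "\<lambda>r. - int r" UNIV F] assms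
    by (simp add: o_def summable_on_UNIV_nonneg_real_iff inj_on_def)
  have "(UNIV :: int set) = {0..} \<union> {..0}" by auto
  then have "F summable_on UNIV \<longleftrightarrow> F summable_on {0..} \<and> F summable_on {..0}"
    by (metis summable_on_union summable_on_subset_banach subset_UNIV)
  then show ?thesis using pos neg by simp
qed

lemma int_constant_if_shift_invariant:
  fixes D :: "int \<Rightarrow> 'a"
  assumes "\<And>x. D x = D (x - 1)"
  shows "D x = D 0"
proof (induction x rule: int_induct[where k = 0])
  case (step1 i)
  then show ?case using assms[of "i + 1"] by simp
next
  case (step2 i)
  then show ?case using assms[of i] by simp
qed simp

lemma laplacian_eq:
  assumes "star_two_rays b m"
  shows "laplacian b m f x =
    (b x (x + 1) * (f x - f (x + 1)) + b x (x - 1) * (f x - f (x - 1))) / m x"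
proof -
  have "b x y = 0" if "y \<notin> {x - 1, x + 1}" for y
  proof -
    have "\<bar>x - y\<bar> \<noteq> 1" using that by auto
    then show ?thesis
      using assms unfolding star_two_rays_def by (metis order_antisym_conv not_less)
  qed
  then have "(\<Sum>\<^sub>\<infinity>y\<in>UNIV. b x y * (f x - f y)) = (\<Sum>\<^sub>\<infinity>y\<in>{x - 1, x + 1}. b x y * (f x - f y))"
    by (intro infsum_cong_neutral) auto
  then show ?thesis by (simp add: laplacian_def)
qed

text \<open>By symmetry of \<open>b\<close>, \<open>m x\<close> times the Laplacian at
  \<open>x\<close> is the flux through the edge entering \<open>x\<close> from the left minus the
  flux through the edge leaving it to the right.\<close>

lemma harmonic_iff_constant_flux:
  assumes "star_two_rays b m"
  shows "harmonic b m f \<longleftrightarrow> (\<exists>\<beta>. \<forall>x. b x (x + 1) * (f (x + 1) - f x) = \<beta>)"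
proof -
  define D where "D x = b x (x + 1) * (f (x + 1) - f x)" for x
  have m: "m x > 0" and sym: "b x y = b y x" for x y
    using assms by (auto simp: star_two_rays_def)
  have "laplacian b m f x = (D (x - 1) - D x) / m x" for x
    using sym[of x "x - 1"] by (simp add: laplacian_eq[OF assms] D_def algebra_simps)
  then have "harmonic b m f \<longleftrightarrow> (\<forall>x. D x = D (x - 1))"
    using m by (auto simp: harmonic_def) (metis less_irrefl)+
  also have "\<dots> \<longleftrightarrow> (\<exists>\<beta>. \<forall>x. D x = \<beta>)"
    using int_constant_if_shift_invariant[of D] by metis
  finally show ?thesis by (simp add: D_def)
qed

text \<open>Here \<open>h\<close> has unit flux. Subtracting \<beta> times \<open>h\<close> from a
  function of flux \<beta> leaves flux zero, hence a constant.\<close>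

lemma harmonic_iff_affine:
  assumes "star_two_rays b m"
    and h: "\<And>x. b x (x + 1) * (h (x + 1) - h x) = 1"
  shows "harmonic b m f \<longleftrightarrow> (\<exists>\<beta> \<gamma>. f = (\<lambda>x. \<gamma> + \<beta> * h x))"
proof
  assume "harmonic b m f"
  then obtain \<beta> where \<beta>: "\<And>x. b x (x + 1) * (f (x + 1) - f x) = \<beta>"
    using harmonic_iff_constant_flux[OF assms(1)] by blast
  define D where "D x = f x - \<beta> * h x" for x
  have "D x = D (x - 1)" for x
  proof -
    have "b (x - 1) x * (D x - D (x - 1)) = 0"
    proof -
      have "b (x - 1) x * (D x - D (x - 1)) =
          b (x - 1) x * (f x - f (x - 1)) - \<beta> * (b (x - 1) x * (h x - h (x - 1)))"
        by (simp add: D_def algebra_simps)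
      then show ?thesis using \<beta>[of "x - 1"] h[of "x - 1"] by simp
    qed
    \<comment> \<open>The unit flux of \<open>h\<close> excludes \<open>b (x - 1) x = 0\<close>, so
      the other factor vanishes.\<close>
    then show ?thesis using h[of "x - 1"] by auto
  qed
  then have "D x = D 0" for x by (rule int_constant_if_shift_invariant)
  then have "f = (\<lambda>x. D 0 + \<beta> * h x)"
    by (auto simp: D_def) (metis diff_add_cancel)
  then show "\<exists>\<beta> \<gamma>. f = (\<lambda>x. \<gamma> + \<beta> * h x)" by blast
next
  assume "\<exists>\<beta> \<gamma>. f = (\<lambda>x. \<gamma> + \<beta> * h x)"
  then obtain \<beta> \<gamma> where f: "f = (\<lambda>x. \<gamma> + \<beta> * h x)" by blast
  have "b x (x + 1) * (f (x + 1) - f x) = \<beta> * (b x (x + 1) * (h (x + 1) - h x))" for x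
    unfolding f by algebra
  then show "harmonic b m f"
    using h harmonic_iff_constant_flux[OF assms(1)] by auto
qed

theorem proposition4p41:
  fixes b :: "int \<Rightarrow> int \<Rightarrow> real" and m :: "int \<Rightarrow> real"
  assumes "star_two_rays b m"
    and "transient_at_top b"
    and "transient_at_bot b"
  shows "\<not> ell2_Liouville b m \<longleftrightarrow>
    (green_ell2_at_top b m \<and> finite_mass_at_bot m) \<or>
    (green_ell2_at_bot b m \<and> finite_mass_at_top m) \<or>
    finite_total_mass m"
proof -
  define a where "a k = 1 / b (int k) (int k + 1)" for k
  define a' where "a' k = 1 / b (- int k) (- int k - 1)" for k
  define A where "A r = suminf a - sum a {..<r}" for r
  define A' where "A' r = suminf a' - sum a' {..<r}" for r
  have m: "m x > 0" and sym: "b x y = b y x"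
    and bpos: "b x y > 0 \<longleftrightarrow> \<bar>x - y\<bar> = 1" for x y
    using assms(1) by (auto simp: star_two_rays_def)
  have a: "summable a" "\<And>k. a k > 0" and a': "summable a'" "\<And>k. a' k > 0"
    using assms(2,3) bpos
    by (auto simp: transient_at_top_def transient_at_bot_def a_def[abs_def] a'_def[abs_def])
  have A_lim: "A \<longlonglongrightarrow> 0" "A' \<longlonglongrightarrow> 0"
    using tail_tendsto_0[OF a(1)] tail_tendsto_0[OF a'(1)]
    by (simp_all add: A_def[abs_def] A'_def[abs_def])
  have A_0: "A 0 > 0" "A' 0 > 0"
    using a a' by (auto simp: A_def A'_def intro!: suminf_pos)
  have tails: "(\<Sum>\<^sub>\<infinity>k\<in>{r..}. a k) = A r" "(\<Sum>\<^sub>\<infinity>k\<in>{r..}. a' k) = A' r" for r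
    unfolding A_def A'_def using a a' by (auto intro!: infsum_atLeast_tail less_imp_le)
  have green: "green_ell2_at_top b m \<longleftrightarrow> summable (\<lambda>r. (A r)\<^sup>2 * m (int r))"
    "green_ell2_at_bot b m \<longleftrightarrow> summable (\<lambda>r. (A' r)\<^sup>2 * m (- int r))"
    using assms(2,3) unfolding green_ell2_at_top_def green_ell2_at_bot_def
    by (simp_all flip: a_def a'_def add: tails)
  have total: "finite_total_mass m \<longleftrightarrow> finite_mass_at_top m \<and> finite_mass_at_bot m"
    unfolding finite_total_mass_def finite_mass_at_top_def finite_mass_at_bot_def
    using m by (intro summable_on_int_iff less_imp_le)

  \<comment> \<open>The potential of unit flux with \<open>h 0 = 0\<close>. It tends to
    \<open>A 0\<close> at \<infinity> and to \<open>- A' 0\<close> at -\<infinity>. Both branches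
    would give 0 at 0, so \<open>h_bot\<close> also holds for \<open>r = 0\<close>.\<close>
  define h where "h x = (if x \<ge> 0 then A 0 - A (nat x) else A' (nat (- x)) - A' 0)" for x
  have h_top: "h (int r) = A 0 - A r" and h_bot: "h (- int r) = A' r - A' 0" for r
    by (auto simp: h_def)
  have h_step: "b x (x + 1) * (h (x + 1) - h x) = 1" for x
  proof (cases "x \<ge> 0")
    case True
    then obtain k where x: "x = int k" by (metis nonneg_int_cases)
    have "h (x + 1) - h x = a k"
      using h_top[of "Suc k"] h_top[of k] by (simp add: x A_def add.commute)
    then show ?thesis using a(2)[of k] by (auto simp: x a_def)
  next
    case False
    \<comment> \<open>On the negative ray edges are numbered by the endpoint nearer to 0, which is
      \<open>x + 1\<close>; hence the shift by one. Since \<open>a'\<close> reads the edge outwards,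
      symmetry of \<open>b\<close> is needed below.\<close>
    define k where "k = nat (- x - 1)"
    have x: "x = - int (Suc k)" using False by (simp add: k_def)
    have "h (x + 1) - h x = a' k"
      using h_bot[of "Suc k"] h_bot[of k] by (simp add: x A'_def)
    moreover have "a' k = 1 / b x (x + 1)"
    proof -
      have "x + 1 = - int k" "- int k - 1 = x" using x by simp_all
      then show ?thesis by (simp only: a'_def sym[of x "- int k"])
    qed
    ultimately show ?thesis using a'(2)[of k] by auto
  qed

  \<comment> \<open>The two tested quantities are the limits of the function at \<infinity> and
    -\<infinity>. Around them it differs by \<beta> times a tail, with negative sign at
    \<infinity>.\<close>
  have ell2: "(\<lambda>x. \<gamma> + \<beta> * h x) \<in> ell2 m \<longleftrightarrow>
      (if \<gamma> + \<beta> * A 0 = 0 then green_ell2_at_top b m else finite_mass_at_top m) \<and>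
      (if \<gamma> - \<beta> * A' 0 = 0 then green_ell2_at_bot b m else finite_mass_at_bot m)"
    if "\<beta> \<noteq> 0" for \<beta> \<gamma>
  proof -
    have "(\<lambda>x. \<gamma> + \<beta> * h x) \<in> ell2 m \<longleftrightarrow>
        summable (\<lambda>r. (\<gamma> + \<beta> * h (int r))\<^sup>2 * m (int r)) \<and>
        summable (\<lambda>r. (\<gamma> + \<beta> * h (- int r))\<^sup>2 * m (- int r))"
      unfolding ell2_def mem_Collect_eq
      using m by (intro summable_on_int_iff mult_nonneg_nonneg) (auto intro: less_imp_le)
    also have "(\<lambda>r. (\<gamma> + \<beta> * h (int r))\<^sup>2 * m (int r)) =
        (\<lambda>r. ((\<gamma> + \<beta> * A 0) + (- \<beta>) * A r)\<^sup>2 * m (int r))"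
      by (simp add: h_top algebra_simps)
    also have "summable \<dots> \<longleftrightarrow>
        (if \<gamma> + \<beta> * A 0 = 0 then green_ell2_at_top b m else finite_mass_at_top m)"
      unfolding green finite_mass_at_top_def
      using m A_lim that by (intro summable_square_weighted_iff) (auto intro: less_imp_le)
    also have "(\<lambda>r. (\<gamma> + \<beta> * h (- int r))\<^sup>2 * m (- int r)) =
        (\<lambda>r. ((\<gamma> - \<beta> * A' 0) + \<beta> * A' r)\<^sup>2 * m (- int r))"
      by (simp add: h_bot algebra_simps)
    also have "summable \<dots> \<longleftrightarrow>
        (if \<gamma> - \<beta> * A' 0 = 0 then green_ell2_at_bot b m else finite_mass_at_bot m)"
      unfolding green finite_mass_at_bot_def
      using m A_lim that by (intro summable_square_weighted_iff) (auto intro: less_imp_le)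
    finally show ?thesis .
  qed

  have nonconst: "(\<lambda>x. \<gamma> + \<beta> * h x) constant_on UNIV \<longleftrightarrow> \<beta> = 0" for \<beta> \<gamma>
  proof
    assume "(\<lambda>x. \<gamma> + \<beta> * h x) constant_on UNIV"
    then obtain c where "\<gamma> + \<beta> * h x = c" for x
      by (auto simp: constant_on_def)
    from this[of 0] this[of 1] have "\<beta> * h 0 = \<beta> * h 1" by linarith
    then show "\<beta> = 0" using h_step[of 0] by auto
  qed (auto simp: constant_on_def)

  have "\<not> ell2_Liouville b m \<longleftrightarrow>
      (\<exists>\<beta> \<gamma>. \<beta> \<noteq> 0 \<and> (\<lambda>x. \<gamma> + \<beta> * h x) \<in> ell2 m)"
    unfolding ell2_Liouville_def harmonic_iff_affine[OF assms(1) h_step]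
    using nonconst by blast
  also have "\<dots> \<longleftrightarrow>
    (green_ell2_at_top b m \<and> finite_mass_at_bot m) \<or>
    (green_ell2_at_bot b m \<and> finite_mass_at_top m) \<or>
    finite_total_mass m" (is "?L \<longleftrightarrow> ?R")
  proof
    assume ?L
    then obtain \<beta> \<gamma> where \<beta>: "\<beta> \<noteq> 0" and f: "(\<lambda>x. \<gamma> + \<beta> * h x) \<in> ell2 m" by blast
    \<comment> \<open>This is the difference of the two limits, so they cannot both vanish.\<close>
    have "\<beta> * (A 0 + A' 0) \<noteq> 0" using \<beta> A_0 by simp
    then have "\<not> (\<gamma> + \<beta> * A 0 = 0 \<and> \<gamma> - \<beta> * A' 0 = 0)" by (auto simp: algebra_simps)
    then show ?R using f unfolding ell2[OF \<beta>] total by (auto split: if_splits)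
  next
    assume ?R
    then consider "green_ell2_at_top b m" "finite_mass_at_bot m"
      | "green_ell2_at_bot b m" "finite_mass_at_top m"
      | "finite_mass_at_top m" "finite_mass_at_bot m"
      unfolding total by blast
    then show ?L
    proof cases
      case 1
      \<comment> \<open>This shift makes the limit at \<infinity> zero and the other one
        \<open>- A 0 - A' 0\<close>, which is negative. The next case mirrors it.\<close>
      then have "(\<lambda>x. - A 0 + 1 * h x) \<in> ell2 m" using A_0 by (subst ell2) auto
      then show ?thesis by - (rule exI[of _ 1], rule exI[of _ "- A 0"], simp)
    next
      case 2
      then have "(\<lambda>x. A' 0 + 1 * h x) \<in> ell2 m" using A_0 by (subst ell2) auto
      then show ?thesis by - (rule exI[of _ 1], rule exI[of _ "A' 0"], simp)
    next
      case 3
      \<comment> \<open>The shift is large enough to make both limits positive: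
        \<open>2 * A 0 + A' 0\<close> at \<infinity> and \<open>A 0\<close> at -\<infinity>.\<close>
      then have "(\<lambda>x. (A 0 + A' 0) + 1 * h x) \<in> ell2 m" using A_0 by (subst ell2) auto
      then show ?thesis by - (rule exI[of _ 1], rule exI[of _ "A 0 + A' 0"], simp)
    qed
  qed
  finally show ?thesis .
qed

end
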